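(* Let $X$ be a nonnegative continuous random variable with a density that is decreasing on $[0,\infty)$, let $0 \leq c \leq a$, and let $U$ be a random variable independent of $X$ that is uniformly distributed over $[-c,c]$. Then $$\mathbb{P}(X + U \geq a) \geq \mathbb{P}(X \geq a).$$
   Context: A continuous random variable is a real random variable whose distribution has a density with respect to Lebesgue measure. "Decreasing" is understood in the weak sense (nonincreasing). When $c = 0$, the uniform distribution over $[-c,c]=\{0\}$ is the point mass at $0$. *)

theory Defs
  imports "HOL-Probability.Probability"
begin

text \<open>
  The law of the uniform distribution on \<open>[-c, c]\<close>, as a measure on the Borel sets.
  For \<open>c = 0\<close> the interval is a Lebesgue null set, so \<^const>\<open>uniform_measure\<close> would be
  degenerate there; the intended law is the point mass at \<open>0\<close>.
\<close>

definition symmetric_uniform :: "real \<Rightarrow> real measure" where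
  "symmetric_uniform c =
    (if c = 0 then return borel 0 else uniform_measure lborel {- c..c})"

end

theory Submission
  imports Defs
begin

text \<open>
  Let \<open>T x\<close> be the probability that \<open>X\<close> is at least \<open>x\<close>. Since the density of \<open>X\<close> decreases on
  the nonnegative reals, the tail \<open>T\<close> is convex there, so \<open>2 * T a \<le> T (a - t) + T (a + t)\<close>
  whenever \<open>\<bar>t\<bar> \<le> a\<close> (\<open>tail_midpoint_convex\<close>). By independence the probability that \<open>X + U\<close> is at
  least \<open>a\<close> is the mean of \<open>T (a - U)\<close>, and because \<open>U\<close> and \<open>- U\<close> have the same law this is also
  the mean of \<open>T (a + U)\<close>. Averaging the two and using \<open>\<bar>U\<bar> \<le> c \<le> a\<close>, midpoint convexity
  gives the lower bound \<open>T a\<close> (\<open>symmetric_shift_increases_tail\<close>). Of the uniform law, only its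
  symmetry and its support enter.

  The comparison is carried out in the extended nonnegative reals: this avoids all integrability
  questions and admits a density that is infinite at \<open>0\<close>.
\<close>

text \<open>
  Both masses are compared with \<open>f a * t\<close>: to the left of \<open>a\<close> the density is at least \<open>f a\<close>, to the
  right it is at most \<open>f a\<close>. The bound \<open>t \<le> a\<close> keeps the left interval in the region where \<open>f\<close>
  decreases.
\<close>

lemma antimono_density_reflection:
  fixes f :: "real \<Rightarrow> ennreal"
  assumes [measurable]: "f \<in> borel_measurable borel"
    and anti: "antimono_on {0..} f" and t: "0 \<le> t" "t \<le> a"
  shows "emeasure (density lborel f) {a..<a + t} \<le> emeasure (density lborel f) {a - t..<a}"
proof -
  have mono: "f y \<le> f x" if "0 \<le> x" "x \<le> y" for x y
    using that monotone_onD[OF anti, of x y] by simp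
  have "emeasure (density lborel f) {a..<a + t}
      = (\<integral>\<^sup>+x. f x * indicator {a..<a + t} x \<partial>lborel)"
    by (simp add: emeasure_density)
  also have "\<dots> \<le> (\<integral>\<^sup>+x. f a * indicator {a..<a + t} x \<partial>lborel)"
    using t by (intro nn_integral_mono) (auto simp: indicator_def intro!: mono)
  also have "\<dots> = f a * ennreal t"
    using t by (simp add: nn_integral_cmult_indicator)
  also have "\<dots> = (\<integral>\<^sup>+x. f a * indicator {a - t..<a} x \<partial>lborel)"
    using t by (simp add: nn_integral_cmult_indicator)
  also have "\<dots> \<le> (\<integral>\<^sup>+x. f x * indicator {a - t..<a} x \<partial>lborel)"
    using t by (intro nn_integral_mono) (auto simp: indicator_def intro!: mono)
  also have "\<dots> = emeasure (density lborel f) {a - t..<a}"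
    by (simp add: emeasure_density)
  finally show ?thesis .
qed

lemma tail_midpoint_convex:
  fixes f :: "real \<Rightarrow> ennreal"
  assumes f: "f \<in> borel_measurable borel" "antimono_on {0..} f" and t: "\<bar>t\<bar> \<le> a"
  shows "2 * emeasure (density lborel f) {a..}
       \<le> emeasure (density lborel f) {a - t..} + emeasure (density lborel f) {a + t..}"
proof -
  let ?T = "\<lambda>x. emeasure (density lborel f) {x..}"
  have split: "?T x = emeasure (density lborel f) {x..<y} + ?T y" if "x \<le> y" for x y
  proof -
    have "{x..} = {x..<y} \<union> {y..}" using that by auto
    moreover have "emeasure (density lborel f) ({x..<y} \<union> {y..})
        = emeasure (density lborel f) {x..<y} + ?T y"
      by (rule plus_emeasure[symmetric]) auto
    ultimately show ?thesis by simp
  qed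
  have nonneg: "2 * ?T a \<le> ?T (a - s) + ?T (a + s)" if s: "0 \<le> s" "s \<le> a" for s
  proof -
    have "2 * ?T a = ?T a + (emeasure (density lborel f) {a..<a + s} + ?T (a + s))"
      using split[of a "a + s"] s by (simp add: mult_2)
    also have "\<dots> \<le> ?T a + (emeasure (density lborel f) {a - s..<a} + ?T (a + s))"
      by (intro add_mono order_refl antimono_density_reflection f s)
    also have "\<dots> = ?T (a - s) + ?T (a + s)"
      using split[of "a - s" a] s by (simp add: ac_simps)
    finally show ?thesis .
  qed
  show ?thesis
    using nonneg[of "\<bar>t\<bar>"] t by (cases "0 \<le> t") (auto simp: add.commute)
qed

lemma sets_sum_ge: "{z :: real \<times> real. a \<le> fst z + snd z} \<in> sets (borel \<Otimes>\<^sub>M borel)"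
proof -
  have "{z \<in> space (borel \<Otimes>\<^sub>M borel :: (real \<times> real) measure). a \<le> fst z + snd z}
      \<in> sets (borel \<Otimes>\<^sub>M borel)"
    by measurable
  then show ?thesis by (simp add: space_pair_measure)
qed

text \<open>
  Fubini turns the tail of the sum into the \<open>Q\<close>-mean of \<open>P {a - u..}\<close>; the reflection \<open>u \<mapsto> - u\<close>
  lets midpoint convexity be applied under the integral sign.
\<close>

lemma symmetric_shift_increases_tail:
  fixes P Q :: "real measure"
  assumes P: "prob_space P" and Q: "prob_space Q"
    and [measurable_cong]: "sets P = sets borel" "sets Q = sets borel"
    and sym: "distr Q borel uminus = Q"
    and mid: "AE u in Q. 2 * emeasure P {a..} \<le> emeasure P {a - u..} + emeasure P {a + u..}"
  shows "emeasure P {a..} \<le> emeasure (P \<Otimes>\<^sub>M Q) {z. a \<le> fst z + snd z}"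
proof -
  interpret P: prob_space P by fact
  interpret Q: prob_space Q by fact
  interpret pair_sigma_finite P Q ..
  let ?G = "\<lambda>u. emeasure P {a - u..}"
  have S: "{z :: real \<times> real. a \<le> fst z + snd z} \<in> sets (P \<Otimes>\<^sub>M Q)"
    using sets_sum_ge[of a] by (simp cong: sets_pair_measure_cong add: assms(3,4))
  have slice: "(\<lambda>x. (x, u)) -` {z. a \<le> fst z + snd z} = {a - u..}" for u
    by auto
  have mG [measurable]: "?G \<in> borel_measurable borel"
    using measurable_emeasure_Pair2[OF S]
    by (simp only: slice measurable_cong_sets[OF assms(4) refl])
  have sum_eq: "emeasure (P \<Otimes>\<^sub>M Q) {z. a \<le> fst z + snd z} = (\<integral>\<^sup>+u. ?G u \<partial>Q)"
    using emeasure_pair_measure_alt2[OF S] by (simp only: slice)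
  have "(\<integral>\<^sup>+u. ?G u \<partial>Q) = (\<integral>\<^sup>+u. ?G u \<partial>distr Q borel uminus)"
    by (simp add: sym)
  also have "\<dots> = (\<integral>\<^sup>+u. ?G (- u) \<partial>Q)"
    by (intro nn_integral_distr) measurable
  finally have reflect: "(\<integral>\<^sup>+u. ?G u \<partial>Q) = (\<integral>\<^sup>+u. ?G (- u) \<partial>Q)" .
  have "2 * emeasure P {a..} = (\<integral>\<^sup>+u. 2 * emeasure P {a..} \<partial>Q)"
    by (simp add: Q.emeasure_space_1)
  also have "\<dots> \<le> (\<integral>\<^sup>+u. ?G u + ?G (- u) \<partial>Q)"
    using mid by (intro nn_integral_mono_AE) simp
  also have "\<dots> = (\<integral>\<^sup>+u. ?G u \<partial>Q) + (\<integral>\<^sup>+u. ?G (- u) \<partial>Q)"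
    by (intro nn_integral_add) measurable
  also have "\<dots> = 2 * (\<integral>\<^sup>+u. ?G u \<partial>Q)"
    by (simp add: reflect mult_2)
  finally show ?thesis
    by (simp add: sum_eq ennreal_mult_le_mult_iff)
qed

lemma distr_uminus_symmetric_uniform:
  "distr (symmetric_uniform c) borel uminus = symmetric_uniform c"
proof (cases "c = 0")
  case True
  then show ?thesis by (simp add: symmetric_uniform_def distr_return)
next
  case False
  have "distr (uniform_measure lborel {- c..c}) borel uminus = uniform_measure lborel {- c..c}"
  proof (rule measure_eqI)
    fix A :: "real set"
    assume "A \<in> sets (distr (uniform_measure lborel {- c..c}) borel uminus)"
    then have A [measurable]: "A \<in> sets borel" by simp
    have mA [measurable]: "uminus -` A \<in> sets borel"
      using measurable_sets_borel[OF borel_measurable_uminus[OF measurable_ident_sets[OF refl]] A]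
      by simp
    have "emeasure lborel ({- c..c} \<inter> A) = emeasure (distr lborel borel uminus) ({- c..c} \<inter> A)"
      by (simp add: lborel_distr_uminus)
    also have "\<dots> = emeasure lborel (uminus -` ({- c..c} \<inter> A))"
      by (subst emeasure_distr) auto
    also have "uminus -` ({- c..c} \<inter> A) = {- c..c} \<inter> uminus -` A"
      by auto
    finally have "emeasure lborel ({- c..c} \<inter> A) = emeasure lborel ({- c..c} \<inter> uminus -` A)" .
    then show "emeasure (distr (uniform_measure lborel {- c..c}) borel uminus) A
        = emeasure (uniform_measure lborel {- c..c}) A"
      by (simp add: emeasure_distr)
  qed simp
  with False show ?thesis by (simp add: symmetric_uniform_def)
qed

text \<open>
  For negative \<open>c\<close> the interval is empty, \<open>symmetric_uniform c\<close> is the null measure, and the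
  bound holds vacuously.
\<close>

lemma AE_symmetric_uniform_abs_le: "AE u in symmetric_uniform c. \<bar>u\<bar> \<le> c"
proof (cases "c = 0")
  case True
  have "AE u in return borel (0::real). \<bar>u\<bar> \<le> c"
    by (subst AE_return) (auto simp: True)
  moreover have "symmetric_uniform c = return borel 0"
    by (simp add: symmetric_uniform_def True)
  ultimately show ?thesis by (simp only:)
next
  case False
  then have "AE u in uniform_measure lborel {- c..c}. \<bar>u\<bar> \<le> c"
    by (intro AE_uniform_measureI) auto
  moreover have "symmetric_uniform c = uniform_measure lborel {- c..c}"
    by (simp add: symmetric_uniform_def False)
  ultimately show ?thesis by (simp only:)
qed

theorem lemma6:
  fixes M :: "'a measure"
    and X U :: "'a \<Rightarrow> real"
    and f :: "real \<Rightarrow> ennreal"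
    and a c :: real
  assumes "prob_space M"
    and "AE \<omega> in M. 0 \<le> X \<omega>"
    and "distributed M lborel X f"
    and "antimono_on {0..} f"
    and "0 \<le> c" and "c \<le> a"
    and "U \<in> borel_measurable M"
    and "distr M borel U = symmetric_uniform c"
    and "prob_space.indep_var M borel X borel U"
  shows "\<P>(\<omega> in M. X \<omega> + U \<omega> \<ge> a) \<ge> \<P>(\<omega> in M. X \<omega> \<ge> a)"
proof -
  interpret prob_space M by fact
  let ?P = "density lborel f" and ?Q = "symmetric_uniform c"
  have X [measurable]: "X \<in> borel_measurable M"
    using distributed_measurable[OF assms(3)] by simp
  note U [measurable] = assms(7)
  have f [measurable]: "f \<in> borel_measurable borel"
    using distributed_borel_measurable[OF assms(3)] by simp
  have P: "distr M borel X = ?P"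
    using distributed_distr_eq_density[OF assms(3)] by (simp cong: distr_cong)
  have joint: "distr M (borel \<Otimes>\<^sub>M borel) (\<lambda>\<omega>. (X \<omega>, U \<omega>)) = ?P \<Otimes>\<^sub>M ?Q"
    using assms(9) by (simp add: indep_var_distribution_eq P assms(8))
  have "AE u in ?Q. 2 * emeasure ?P {a..} \<le> emeasure ?P {a - u..} + emeasure ?P {a + u..}"
    using AE_symmetric_uniform_abs_le[of c]
  proof eventually_elim
    case (elim u)
    then show ?case
      using assms(6) by (intro tail_midpoint_convex f assms(4)) simp
  qed
  moreover have "prob_space ?P" "prob_space ?Q"
    using prob_space_distr[OF X] prob_space_distr[OF U] by (simp_all add: P assms(8))
  moreover have "sets ?Q = sets borel"
    by (simp add: assms(8)[symmetric])
  ultimately have "emeasure ?P {a..} \<le> emeasure (?P \<Otimes>\<^sub>M ?Q) {z. a \<le> fst z + snd z}"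
    by (intro symmetric_shift_increases_tail distr_uminus_symmetric_uniform) simp_all
  also have "\<dots> = emeasure M {\<omega> \<in> space M. a \<le> X \<omega> + U \<omega>}"
  proof -
    show ?thesis
      unfolding joint[symmetric] using sets_sum_ge[of a]
      by (subst emeasure_distr) (auto intro!: arg_cong[where f = "emeasure M"])
  qed
  finally have "emeasure ?P {a..} \<le> emeasure M {\<omega> \<in> space M. a \<le> X \<omega> + U \<omega>}" .
  moreover have "emeasure ?P {a..} = emeasure M {\<omega> \<in> space M. a \<le> X \<omega>}"
    unfolding P[symmetric]
    by (subst emeasure_distr) (auto intro!: arg_cong[where f = "emeasure M"])
  ultimately show ?thesis
    by (simp add: emeasure_eq_measure)
qed

end
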